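(* Let $K_n$ be a complete graph with $n$ vertices. Under both the segment-crossing criterion and the segment-intersection criterion, the geometric pseudo-Grundy index of $K_n$ satisfies $$\gamma'_g(K_n)\le \frac{n^2}{9}+\Theta(n).$$
   Context: A geometric graph of a graph $G$ is a drawing of $G$ in the plane in which the vertices are points in general position (no three collinear) and every edge is the straight-line segment joining its endpoints. Two distinct edges cross if they meet at a point interior to both segments; they intersect if they share an endpoint or cross. Segment-crossing criterion: two distinct edges are adjacent if and only if they cross. Segment-intersection criterion: two distinct edges are adjacent if and only if they intersect. For a fixed adjacency criterion, a pseudo-Grundy $k$-coloring of a geometric graph $\mathsf{G}$ is an assignment of the colors $1,\dots,k$ to all the edges (not necessarily proper), with every color used, such that for every pair of colors $i<j$, every edge of color $j$ is adjacent to at least one edge of color $i$. The pseudo-Grundy index $\gamma'(\mathsf{G})$ is the largest $k$ for which $\mathsf{G}$ has a pseudo-Grundy $k$-coloring. The geometric pseudo-Grundy index of a graph $G$ is $\gamma'_g(G)=\min\{\gamma'(\mathsf{G}) : \mathsf{G}\text{ is a geometric graph of } G\}$. The term $\Theta(n)$ in the upper bound denotes an error term that is linear in $n$: there is a constant $C>0$ such that $\gamma'_g(K_n)\le \frac{n^2}{9}+Cn$. *)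

theory Defs
  imports "HOL-Analysis.Analysis"
begin

(* A simple graph is given by a vertex set V and a set E of two-element subsets of V.
   A geometric graph of it is described by the map p sending each vertex to its point. *)

definition all_edges :: "'a set \<Rightarrow> 'a set set" where
  "all_edges V = {e. e \<subseteq> V \<and> card e = 2}"

definition geometric_drawing :: "'a set \<Rightarrow> ('a \<Rightarrow> real^2) \<Rightarrow> bool" where
  "geometric_drawing V p \<longleftrightarrow>
     inj_on p V \<and>
     (\<forall>u\<in>V. \<forall>v\<in>V. \<forall>w\<in>V. u \<noteq> v \<and> v \<noteq> w \<and> u \<noteq> w \<longrightarrow> \<not> collinear {p u, p v, p w})"

definition edge_interior :: "('a \<Rightarrow> real^2) \<Rightarrow> 'a set \<Rightarrow> (real^2) set" where
  "edge_interior p e = {x. \<exists>u v. e = {u, v} \<and> x \<in> open_segment (p u) (p v)}"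

definition crossing :: "('a \<Rightarrow> real^2) \<Rightarrow> 'a set \<Rightarrow> 'a set \<Rightarrow> bool" where
  "crossing p e f \<longleftrightarrow> e \<noteq> f \<and> edge_interior p e \<inter> edge_interior p f \<noteq> {}"

definition intersecting :: "('a \<Rightarrow> real^2) \<Rightarrow> 'a set \<Rightarrow> 'a set \<Rightarrow> bool" where
  "intersecting p e f \<longleftrightarrow> e \<noteq> f \<and> (e \<inter> f \<noteq> {} \<or> crossing p e f)"

definition pseudo_grundy_coloring ::
    "('e \<Rightarrow> 'e \<Rightarrow> bool) \<Rightarrow> 'e set \<Rightarrow> nat \<Rightarrow> ('e \<Rightarrow> nat) \<Rightarrow> bool" where
  "pseudo_grundy_coloring adj E k c \<longleftrightarrow>
     c ` E = {1..k} \<and>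
     (\<forall>i\<in>{1..k}. \<forall>j\<in>{1..k}. i < j \<longrightarrow>
        (\<forall>e\<in>E. c e = j \<longrightarrow> (\<exists>f\<in>E. c f = i \<and> adj e f)))"

definition pseudo_grundy_index :: "('e \<Rightarrow> 'e \<Rightarrow> bool) \<Rightarrow> 'e set \<Rightarrow> nat" where
  "pseudo_grundy_index adj E = (GREATEST k. \<exists>c. pseudo_grundy_coloring adj E k c)"

(* The adjacency criterion crit (crossing or intersecting) depends on the drawing. *)
definition geometric_pseudo_grundy_index ::
    "(('a \<Rightarrow> real^2) \<Rightarrow> 'a set \<Rightarrow> 'a set \<Rightarrow> bool) \<Rightarrow> 'a set \<Rightarrow> 'a set set \<Rightarrow> nat" where
  "geometric_pseudo_grundy_index crit V E =
     (LEAST m. \<exists>p. geometric_drawing V p \<and> m = pseudo_grundy_index (crit p) E)"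

(* Neither GREATEST nor LEAST above is degenerate for finite graphs: colorings exist, they
   use at most card E colors, and every countable vertex set has a drawing (on a parabola). *)

lemma pseudo_grundy_coloring_le_card:
  assumes "finite E" "pseudo_grundy_coloring adj E k c"
  shows "k \<le> card E"
  using assms card_image_le[of E c] by (simp add: pseudo_grundy_coloring_def)

lemma pseudo_grundy_coloring_exists:
  "\<exists>k c. pseudo_grundy_coloring adj E k c"
proof (cases "E = {}")
  case True
  then have "pseudo_grundy_coloring adj E 0 (\<lambda>_. 1)"
    by (simp add: pseudo_grundy_coloring_def)
  then show ?thesis by blast
next
  case False
  then have "pseudo_grundy_coloring adj E 1 (\<lambda>_. 1)"
    by (auto simp: pseudo_grundy_coloring_def)
  then show ?thesis by blast
qed

lemma geometric_drawing_exists: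
  assumes "countable V"
  shows "\<exists>p. geometric_drawing V p"
proof -
  obtain t :: "'a \<Rightarrow> nat" where t: "inj_on t V"
    using assms by (auto simp: countable_def)
  define p :: "'a \<Rightarrow> real^2" where "p v = vector [real (t v), (real (t v))\<^sup>2]" for v
  have p1: "p v $ 1 = real (t v)" and p2: "p v $ 2 = (real (t v))\<^sup>2" for v
    by (simp_all add: p_def)
  have "inj_on p V"
    using t p1 by (metis inj_on_def of_nat_eq_iff)
  moreover have "\<not> collinear {p u, p v, p w}"
    if "u \<in> V" "v \<in> V" "w \<in> V" "u \<noteq> v" "v \<noteq> w" "u \<noteq> w" for u v w
  proof
    assume "collinear {p u, p v, p w}"
    then obtain d where d: "\<forall>x\<in>{p u, p v, p w}. \<forall>y\<in>{p u, p v, p w}. \<exists>c. x - y = c *\<^sub>R d"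
      by (auto simp: collinear_def)
    then obtain a b where a: "p u - p v = a *\<^sub>R d" and b: "p w - p v = b *\<^sub>R d"
      by blast
    define x y z where "x = real (t u)" and "y = real (t v)" and "z = real (t w)"
    have ne: "x \<noteq> y" "y \<noteq> z" "x \<noteq> z"
      using that t by (auto simp: x_def y_def z_def inj_on_def)
    have 1: "x - y = a * d $ 1" "x\<^sup>2 - y\<^sup>2 = a * d $ 2" "z - y = b * d $ 1" "z\<^sup>2 - y\<^sup>2 = b * d $ 2"
      using arg_cong[OF a, of "\<lambda>q. q $ 1"] arg_cong[OF a, of "\<lambda>q. q $ 2"]
            arg_cong[OF b, of "\<lambda>q. q $ 1"] arg_cong[OF b, of "\<lambda>q. q $ 2"]
      by (simp_all add: p1 p2 x_def y_def z_def)
    have "(x - y) * (z\<^sup>2 - y\<^sup>2) = (z - y) * (x\<^sup>2 - y\<^sup>2)"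
      by (simp only: 1) simp
    then have "(x - y) * (z - y) * (z - x) = 0"
      by (simp add: power2_eq_square algebra_simps)
    then show False using ne by simp
  qed
  ultimately show ?thesis
    unfolding geometric_drawing_def by blast
qed

end

theory Submission
  imports Defs
begin

text \<open>
  An edge of the largest color \<open>k\<close> has a neighbor in each of the \<open>k - 1\<close> smaller colors, so \<open>k\<close>
  exceeds the largest number of neighbors of an edge by at most one
  (\<open>pseudo_grundy_index_le_degree\<close>). The index is a minimum over all drawings, so it is enough
  to draw \<open>K\<^sub>n\<close> in such a way that each edge crosses at most \<open>n\<^sup>2 / 9\<close> others. Sharing an endpoint
  instead of crossing accounts for at most \<open>2 n\<close> further neighbors, which the linear term absorbs.

  The drawing places a third of the vertices on each of three arms A, B, C that leave the origin
  in three directions, in counterclockwise order. If the arms were straight, an edge from the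
  fraction \<open>x\<close> of A to the fraction \<open>y\<close> of B would cross only edges between A and B, namely
  \<open>(x (1 - y) + (1 - x) y) n\<^sup>2 / 9 \<le> n\<^sup>2 / 9\<close> of them. General position forces the arms to bend, and
  then edges within an arm take part in crossings as well. Every arm is bent towards the
  next one, and in each case the total still does not exceed \<open>n\<^sup>2 / 9\<close>.

  Which edges cross depends only on the orientations of triples of vertices, and these follow
  four simple rules (\<open>orient_arm_concave\<close>, \<open>orient_arm_next\<close>, \<open>orient_arm_prev\<close>,
  \<open>orient_three_arms\<close>). The rules give both general position (\<open>drawing_orient_ne_0\<close>) and the possible
  partners of an edge in a crossing (\<open>crossings_between_arms\<close>, \<open>crossings_within_arm\<close>). They are
  invariant under the cyclic shift of the arms, which leaves only two kinds of edges to
  consider: those from an arm to the next one and those within an arm.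
\<close>

section \<open>Orientations of triples of points\<close>

text \<open>Twice the signed area of the triangle: positive if \<open>a\<close>, \<open>b\<close>, \<open>c\<close> turn counterclockwise.\<close>

definition orient :: "real^2 \<Rightarrow> real^2 \<Rightarrow> real^2 \<Rightarrow> real" where
  "orient a b c = (b$1 - a$1) * (c$2 - a$2) - (b$2 - a$2) * (c$1 - a$1)"

lemma orient_cycle: "orient b c a = orient a b c"
  by (simp add: orient_def algebra_simps)

lemma orient_swap: "orient b a c = - orient a b c"
  by (simp add: orient_def algebra_simps)

lemma orient_same [simp]: "orient a b a = 0" "orient a b b = 0"
  by (simp_all add: orient_def)

lemma collinear_imp_orient_0:
  assumes "collinear {a, b, c}"
  shows "orient a b c = 0"
proof -
  obtain d where d: "\<forall>x\<in>{a, b, c}. \<forall>y\<in>{a, b, c}. \<exists>r. x - y = r *\<^sub>R d"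
    using assms by (auto simp: collinear_def)
  then obtain r q where "b - a = r *\<^sub>R d" "c - a = q *\<^sub>R d"
    by blast
  then have "b$k - a$k = r * d$k" "c$k - a$k = q * d$k" for k
    by (metis vector_minus_component vector_scaleR_component real_scaleR_def)+
  then show ?thesis
    by (simp add: orient_def)
qed

lemma orient_affine:
  "orient a b ((1 - w) *\<^sub>R c + w *\<^sub>R d) = (1 - w) * orient a b c + w * orient a b d"
  by (simp add: orient_def algebra_simps)

lemma orient_on_line: "orient a b ((1 - w) *\<^sub>R a + w *\<^sub>R b) = 0"
  by (simp add: orient_affine)

lemma crossing_commute: "crossing p e f \<Longrightarrow> crossing p f e"
  by (auto simp: crossing_def)

text \<open>The point where two segments meet is a proper convex combination of \<open>p c\<close> and \<open>p d\<close>, and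
  its orientation with respect to \<open>p a\<close> and \<open>p b\<close> is zero. The edges may share a vertex here; in
  general position the conclusion then shows that they do not cross.\<close>

lemma crossing_orient_opposite:
  assumes gp: "\<And>w. w \<in> {c, d} - {a, b} \<Longrightarrow> orient (p a) (p b) (p w) \<noteq> 0"
    and cr: "crossing p {a, b} {c, d}"
    and ne: "c \<noteq> d"
  shows "orient (p a) (p b) (p c) * orient (p a) (p b) (p d) < 0"
proof -
  let ?o = "\<lambda>x. orient (p a) (p b) x"
  from cr obtain x a' b' c' d'
    where ab: "{a, b} = {a', b'}" "x \<in> open_segment (p a') (p b')"
      and cd: "{c, d} = {c', d'}" "x \<in> open_segment (p c') (p d')"
      and diff: "{a, b} \<noteq> {c, d}"
    unfolding crossing_def edge_interior_def by blast
  have "x \<in> open_segment (p a) (p b)"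
    using ab by (auto simp: doubleton_eq_iff open_segment_commute)
  then have 0: "?o x = 0"
    by (auto simp: in_segment orient_on_line)
  have "x \<in> open_segment (p c) (p d)"
    using cd by (auto simp: doubleton_eq_iff open_segment_commute)
  then obtain w where w: "0 < w" "w < 1" "x = (1 - w) *\<^sub>R p c + w *\<^sub>R p d"
    by (auto simp: in_segment)
  have sum: "(1 - w) * ?o (p c) + w * ?o (p d) = 0"
    using 0 w(3) by (simp add: orient_affine)
  \<comment> \<open>A weighted mean of two numbers vanishes only if both vanish or their signs differ;
      both vanish only if both edges have the same endpoints.\<close>
  have "?o (p c) = 0 \<longleftrightarrow> ?o (p d) = 0"
    using sum w by auto
  moreover have "\<not> (c \<in> {a, b} \<and> d \<in> {a, b})"
    using diff ne by auto
  ultimately have nz: "?o (p c) \<noteq> 0" "?o (p d) \<noteq> 0"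
    using gp by blast+
  have "(1 - w) * (?o (p c) * ?o (p d)) = - (w * (?o (p d))\<^sup>2)"
    using sum by (simp add: power2_eq_square) algebra
  also have "\<dots> < 0"
    using nz w by simp
  finally show ?thesis
    using w by (simp add: mult_less_0_iff)
qed

section \<open>Three curved arms\<close>

text \<open>A linear map of order three and determinant one: in suitable affine coordinates it is the
  rotation by 120 degrees, but its matrix has integer entries. It takes the direction \<open>(1, 0)\<close> to
  \<open>(0, 1)\<close> and that to \<open>(-1, -1)\<close>.\<close>

definition rot :: "real^2 \<Rightarrow> real^2" where
  "rot a = vector [- a$2, a$1 - a$2]"

text \<open>The points lie on the concave curve \<open>y = 1 - 1 / x\<close>, which stays close to the positive first
  axis. With \<open>x \<ge> 2\<close>, the curve is flat enough and far enough from the origin for each secant to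
  separate the other two arms.\<close>

definition base_arm :: "nat \<Rightarrow> real^2" where
  "base_arm i = vector [real i + 2, 1 - 1 / (real i + 2)]"

text \<open>Arm numbers count modulo three (\<open>arm_mod\<close>). Allowing every natural number makes
  \<open>Suc s\<close> the arm after \<open>s\<close> and \<open>Suc (Suc s)\<close> the arm before it, without any reduction.\<close>

definition arm :: "nat \<Rightarrow> nat \<Rightarrow> real^2" where
  "arm s i = (rot ^^ s) (base_arm i)"

lemma rot_nth [simp]: "rot a $ 1 = - a$2" "rot a $ 2 = a$1 - a$2"
  by (simp_all add: rot_def)

lemma rot_cubed: "rot (rot (rot a)) = a"
  by (simp add: vec_eq_iff forall_2)

lemma arm_Suc: "arm (Suc s) i = (rot ^^ s) (rot (base_arm i))"
  by (simp add: arm_def funpow_swap1)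

lemma arm_periodic: "arm (Suc (Suc (Suc s))) i = arm s i"
  by (simp add: arm_def rot_cubed)

lemma arm_mod: "arm (s mod 3) i = arm s i"
proof -
  have "arm (r + 3 * q) i = arm r i" for r q
    by (induction q) (simp_all add: arm_periodic eval_nat_numeral)
  from this[of "s mod 3" "s div 3"] show ?thesis
    by simp
qed

lemma orient_rot: "orient ((rot ^^ s) a) ((rot ^^ s) b) ((rot ^^ s) c) = orient a b c"
  by (induction s) (simp_all add: orient_def algebra_simps)

lemma base_arm_nth [simp]:
  "base_arm i $ 1 = real i + 2" "base_arm i $ 2 = 1 - 1 / (real i + 2)"
  by (simp_all add: base_arm_def)

lemma orient_arm_concave:
  assumes "i < j" "j < k"
  shows "orient (arm s i) (arm s j) (arm s k) < 0"
proof -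
  define x y z where "x = real i + 2" "y = real j + 2" "z = real k + 2"
  have xyz: "0 < x" "x < y" "y < z"
    using assms by (auto simp: x_y_z_def)
  have "orient (arm s i) (arm s j) (arm s k) = (y - x) * (1 / x - 1 / z) - (1 / x - 1 / y) * (z - x)"
    unfolding arm_def orient_rot unfolding orient_def by (simp flip: x_y_z_def)
  also have "\<dots> = - ((y - x) * (z - x) * (z - y) / (x * y * z))"
    using xyz by (simp add: field_simps)
  also have "\<dots> < 0"
    using xyz by simp
  finally show ?thesis .
qed

text \<open>Together with \<open>orient_arm_prev\<close>: a line through two points of an arm has the whole next
  arm on its left and the whole previous arm on its right, seen away from the origin.\<close>

lemma orient_arm_next:
  assumes "i < j"
  shows "orient (arm s i) (arm s j) (arm (Suc s) k) > 0"
proof -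
  define x y z where "x = real i + 2" "y = real j + 2" "z = real k + 2"
  have xyz: "2 \<le> x" "x < y" "2 \<le> z"
    using assms by (auto simp: x_y_z_def)
  have "orient (arm s i) (arm s j) (arm (Suc s) k)
      = (y - x) * (z - 2 + 1 / z + 1 / x) + (1 / x - 1 / y) * (1 - 1 / z + x)"
    unfolding arm_Suc unfolding arm_def orient_rot unfolding orient_def
    by (simp flip: x_y_z_def) (simp add: algebra_simps)
  also have "\<dots> > 0"
  proof -
    have "0 < 1 / x" "0 < 1 / z" "1 / z \<le> 1" "0 < 1 / x - 1 / y"
      using xyz by (auto simp: field_simps)
    then have "0 < z - 2 + 1 / z + 1 / x" "0 < 1 - 1 / z + x"
      using xyz by linarith+
    then show ?thesis
      using xyz \<open>0 < 1 / x - 1 / y\<close> by (simp only: add_pos_pos mult_pos_pos diff_gt_0_iff_gt)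
  qed
  finally show ?thesis .
qed

lemma orient_arm_prev:
  assumes "i < j"
  shows "orient (arm s i) (arm s j) (arm (Suc (Suc s)) k) < 0"
proof -
  define x y z where "x = real i + 2" "y = real j + 2" "z = real k + 2"
  have xyz: "2 \<le> x" "x < y" "2 \<le> z"
    using assms by (auto simp: x_y_z_def)
  define h where "h = 1 / x - 1 / y"
  have h: "h > 0" "y - x = h * (x * y)"
    using xyz by (auto simp: h_def field_simps)
  have "orient (arm s i) (arm s j) (arm (Suc (Suc s)) k)
      = h * (z + x - 1 + 1 / z) - (y - x) * (z + 1 - 1 / x)"
    unfolding arm_def funpow_Suc_right o_def orient_rot unfolding orient_def h_def
    by (simp flip: x_y_z_def) (simp add: algebra_simps)
  \<comment> \<open>Both differences are multiples of the same positive \<open>h\<close>, because the secant through the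
      abscissas \<open>x\<close> and \<open>y\<close> has the slope \<open>1 / (x y)\<close>.\<close>
  also have "\<dots> = h * (z + x - 1 + 1 / z - y * (x * z + x - 1))"
    using xyz unfolding h(2) by (simp add: algebra_simps)
  also have "\<dots> < 0"
  proof -
    define q where "q = x * z"
    have "2 * z \<le> q"
      unfolding q_def using xyz by (intro mult_right_mono) auto
    then have "2 * (q + x - 1) \<le> y * (q + x - 1)"
      using xyz by (intro mult_right_mono) auto
    moreover have "1 / z \<le> 1"
      using xyz by simp
    ultimately have "z + x - 1 + 1 / z - y * (q + x - 1) < 0"
      using xyz \<open>2 * z \<le> q\<close> by (smt (verit))
    then have "z + x - 1 + 1 / z - y * (x * z + x - 1) < 0"
      by (simp only: q_def)
    then show ?thesis
      using h(1) by (simp add: mult_pos_neg)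
  qed
  finally show ?thesis .
qed

text \<open>The origin lies inside each such triangle: the orientation is the sum of the three
  cross products of consecutive vertices, and each of these is positive.\<close>

lemma orient_three_arms: "orient (arm s i) (arm (Suc s) j) (arm (Suc (Suc s)) k) > 0"
proof -
  define x y z where "x = real i + 2" "y = real j + 2" "z = real k + 2"
  define a b c where "a = 1 - 1 / x" "b = 1 - 1 / y" "c = 1 - 1 / z"
  have xyz: "2 \<le> x" "2 \<le> y" "2 \<le> z"
    by (auto simp: x_y_z_def)
  \<comment> \<open>Up to a common rotation, \<open>(x, a)\<close> is the first point, and the other two arise from \<open>(y, b)\<close>
      and \<open>(z, c)\<close> by one and two rotations.\<close>
  have abc: "0 < a" "0 < b" "0 < c" "a < x" "b < y" "c < z"
    using xyz by (auto simp: a_b_c_def field_simps add_strict_increasing)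
  have "orient (arm s i) (arm (Suc s) j) (arm (Suc (Suc s)) k)
      = (x * (y - b) + a * b) + (y * (z - c) + b * c) + (z * (x - a) + c * a)"
    unfolding arm_def funpow_Suc_right o_def orient_rot unfolding orient_def
    by (simp flip: x_y_z_def a_b_c_def) (simp add: algebra_simps)
  also have "\<dots> > 0"
    using xyz abc by (intro add_pos_pos mult_pos_pos) auto
  finally show ?thesis .
qed

section \<open>The drawing and its general position\<close>

text \<open>The residue of a vertex modulo three selects its arm and the quotient its place on the arm.
  Among the vertices below \<open>n\<close> the places range up to \<open>n div 3\<close>, so an arm contributes at most
  \<open>n div 3\<close> vertices besides any given one of its own.\<close>

definition drawing :: "nat \<Rightarrow> real^2" where
  "drawing v = arm v (v div 3)"

definition vert :: "nat \<Rightarrow> nat \<Rightarrow> nat" where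
  "vert s i = 3 * i + s mod 3"

lemma drawing_vert [simp]: "drawing (vert s i) = arm s i"
proof -
  have "vert s i div 3 = i" "vert s i mod 3 = s mod 3"
    by (simp_all add: vert_def)
  then show ?thesis
    by (metis drawing_def arm_mod)
qed

lemma vert_inject [simp]: "vert s i = vert s j \<longleftrightarrow> i = j"
  by (simp add: vert_def)

lemma vert_ne_Suc: "vert s i \<noteq> vert (Suc s) j"
proof
  assume "vert s i = vert (Suc s) j"
  then have "vert s i mod 3 = vert (Suc s) j mod 3"
    by simp
  then have "s mod 3 = Suc s mod 3"
    by (simp add: vert_def)
  then show False
    by (simp add: mod_Suc split: if_splits)
qed

lemma vert_periodic: "vert (Suc (Suc (Suc s))) i = vert s i"
proof -
  have "Suc (Suc (Suc s)) = s + 3"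
    by simp
  then show ?thesis
    unfolding vert_def by (metis mod_add_self2)
qed

lemma vert_cases:
  assumes "v < n"
  obtains (same) i where "i \<le> n div 3" "v = vert s i"
  | ("next") i where "i \<le> n div 3" "v = vert (Suc s) i"
  | (prev) i where "i \<le> n div 3" "v = vert (Suc (Suc s)) i"
proof -
  have i: "v div 3 \<le> n div 3"
    using assms by (intro div_le_mono) auto
  have "v mod 3 < 3" "s mod 3 < 3"
    by simp_all
  then have "v mod 3 = s mod 3 \<or> v mod 3 = Suc s mod 3 \<or> v mod 3 = Suc (Suc s) mod 3"
    by (auto simp: mod_Suc)
  then have "v = vert s (v div 3) \<or> v = vert (Suc s) (v div 3) \<or> v = vert (Suc (Suc s)) (v div 3)"
    unfolding vert_def by (metis mult_div_mod_eq)
  then show thesis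
    using i that by blast
qed

lemma orient_arm_ne_0:
  assumes "i \<noteq> j"
  shows "orient (arm s i) (arm s j) (arm (Suc s) k) \<noteq> 0"
    and "orient (arm s i) (arm s j) (arm (Suc (Suc s)) k) \<noteq> 0"
  using assms orient_arm_next[of i j s k] orient_arm_next[of j i s k]
    orient_arm_prev[of i j s k] orient_arm_prev[of j i s k]
    orient_swap[of "arm s i" "arm s j"]
  by (auto simp: neq_iff)

lemma orient_same_arm_ne_0:
  assumes "i \<noteq> j" "j \<noteq> k" "i \<noteq> k"
  shows "orient (arm s i) (arm s j) (arm s k) \<noteq> 0"
proof -
  have ne: "orient (arm s a) (arm s b) (arm s c) \<noteq> 0" "orient (arm s b) (arm s a) (arm s c) \<noteq> 0"
    if "a < b \<and> b < c" for a b c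
    using orient_arm_concave[of a b c s] that orient_swap[of "arm s b" "arm s a"] by auto
  consider "i < j \<and> j < k" | "i < k \<and> k < j" | "j < i \<and> i < k" | "j < k \<and> k < i"
    | "k < i \<and> i < j" | "k < j \<and> j < i"
    using assms by linarith
  then show ?thesis
    by cases (metis ne orient_cycle)+
qed

text \<open>Counting the arms from that of \<open>u\<close> leaves nine cases for \<open>v\<close> and \<open>w\<close>; each reduces to one of
  the four orientation rules after a permutation of the three vertices.\<close>

lemma drawing_orient_ne_0:
  assumes "u \<noteq> v" "v \<noteq> w" "u \<noteq> w"
  shows "orient (drawing u) (drawing v) (drawing w) \<noteq> 0"
proof -
  obtain i where u: "u = vert u i"
    unfolding vert_def by (metis mult_div_mod_eq)
  define s where "s = u"
  have u: "u = vert s i"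
    using u by (simp add: s_def)
  obtain j k where
    v: "v = vert s j \<or> v = vert (Suc s) j \<or> v = vert (Suc (Suc s)) j" and
    w: "w = vert s k \<or> w = vert (Suc s) k \<or> w = vert (Suc (Suc s)) k"
    using vert_cases[of v "Suc v" s] vert_cases[of w "Suc w" s] by (metis lessI)
  have pos: "orient (arm s i) (arm (Suc s) j) (arm (Suc (Suc s)) k) > 0"
    "orient (arm s i) (arm (Suc s) k) (arm (Suc (Suc s)) j) > 0"
    by (rule orient_three_arms)+
  note ne = orient_arm_ne_0[where s = s] orient_arm_ne_0[where s = "Suc s"]
    orient_arm_ne_0[where s = "Suc (Suc s)"] orient_same_arm_ne_0
  show ?thesis
    using v w
  proof (elim disjE)
    assume "v = vert s j" "w = vert s k"
    then show ?thesis using assms u ne by auto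
  next
    assume "v = vert s j" "w = vert (Suc s) k"
    then show ?thesis using assms u ne by auto
  next
    assume "v = vert s j" "w = vert (Suc (Suc s)) k"
    then show ?thesis using assms u ne by auto
  next
    assume "v = vert (Suc s) j" "w = vert s k"
    then show ?thesis using assms u ne(1)[of k i j] orient_cycle[of "arm s i"] by auto
  next
    assume "v = vert (Suc s) j" "w = vert (Suc s) k"
    then show ?thesis using assms u ne(4)[of j k i] orient_cycle[of "arm (Suc s) j" "arm (Suc s) k" "arm s i"]
      by (auto simp: arm_periodic)
  next
    assume "v = vert (Suc s) j" "w = vert (Suc (Suc s)) k"
    then show ?thesis using u pos by auto
  next
    assume "v = vert (Suc (Suc s)) j" "w = vert s k"
    then show ?thesis using assms u ne(2)[of k i j] orient_cycle[of "arm s i"] by auto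
  next
    assume "v = vert (Suc (Suc s)) j" "w = vert (Suc s) k"
    then show ?thesis using u pos
        orient_swap[of "arm s i" "arm (Suc (Suc s)) j" "arm (Suc s) k"]
        orient_cycle[of "arm s i" "arm (Suc s) k" "arm (Suc (Suc s)) j"] by simp
  next
    assume "v = vert (Suc (Suc s)) j" "w = vert (Suc (Suc s)) k"
    then show ?thesis using assms u ne(5)[of j k i]
        orient_cycle[of "arm (Suc (Suc s)) j" "arm (Suc (Suc s)) k" "arm s i"]
      by (auto simp: arm_periodic)
  qed
qed

lemma geometric_drawing_drawing: "geometric_drawing V drawing"
proof -
  have "inj drawing"
  proof (rule injI, rule ccontr)
    fix u v assume eq: "drawing u = drawing v" and "u \<noteq> v"
    \<comment> \<open>Two coinciding points would be collinear with any third one.\<close>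
    moreover obtain w where "w \<notin> {u, v}"
      using infinite_UNIV_nat by (metis ex_new_if_finite finite.emptyI finite.insertI)
    ultimately have "orient (drawing u) (drawing w) (drawing v) \<noteq> 0"
      by (intro drawing_orient_ne_0) auto
    then show False
      using eq by simp
  qed
  then show ?thesis
    unfolding geometric_drawing_def
    using drawing_orient_ne_0 collinear_imp_orient_0 inj_on_subset by blast
qed

section \<open>Crossings\<close>

text \<open>Naming the endpoints of the crossing edge by the side on which they lie halves the number
  of cases below. The last conclusion says that \<open>u\<close> and \<open>v\<close> are separated by the line
  through \<open>x\<close> and \<open>y\<close>.\<close>

lemma crossing_drawing_obtain:
  assumes uv: "u \<noteq> v" and f: "f \<in> all_edges V" and cr: "crossing drawing {u, v} f"
  obtains x y where "f = {x, y}" "x \<in> V" "y \<in> V"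
    "orient (drawing u) (drawing v) (drawing x) > 0"
    "orient (drawing u) (drawing v) (drawing y) < 0"
    "orient (drawing x) (drawing y) (drawing u) * orient (drawing x) (drawing y) (drawing v) < 0"
proof -
  obtain x y where xy: "f = {x, y}" "x \<noteq> y" "x \<in> V" "y \<in> V"
    using f by (auto simp: all_edges_def card_2_iff)
  have *: "orient (drawing a) (drawing b) (drawing c) * orient (drawing a) (drawing b) (drawing d) < 0"
    if "crossing drawing {a, b} {c, d}" "a \<noteq> b" "c \<noteq> d" for a b c d
    using that drawing_orient_ne_0 by (intro crossing_orient_opposite) auto
  have 1: "orient (drawing u) (drawing v) (drawing x) * orient (drawing u) (drawing v) (drawing y) < 0"
    using * cr uv xy by simp
  have 2: "orient (drawing x) (drawing y) (drawing u) * orient (drawing x) (drawing y) (drawing v) < 0"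
    using * crossing_commute[OF cr] uv xy by simp
  show thesis
  proof (cases "orient (drawing u) (drawing v) (drawing x) > 0")
    case True
    then show ?thesis
      using that[of x y] xy 1 2 by (simp add: mult_less_0_iff)
  next
    case False
    then show ?thesis
      using that[of y x] xy 1 2 orient_swap[of "drawing x" "drawing y"]
      by (auto simp: mult_less_0_iff insert_commute)
  qed
qed

text \<open>Write A, B, C for the arms starting with \<open>s\<close>. To the left of the edge from \<open>A i\<close> to \<open>B j\<close> lie
  the earlier points of A and B and all of C, to its right the later points of A and B. Of the six
  combinations of a left with a right endpoint, three are excluded because the line through
  them does not separate \<open>A i\<close> from \<open>B j\<close>.\<close>

lemma crossings_between_arms:
  assumes f: "f \<in> all_edges {..<n}" and cr: "crossing drawing {vert s i, vert (Suc s) j} f"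
  defines "M \<equiv> n div 3"
  shows "f \<in> (\<lambda>(x, y). {x, y}) `
    (vert (Suc s) ` {..<j} \<times> vert s ` {i<..M}
     \<union> (vert s ` {..<i} \<union> vert (Suc s) ` {..<j}) \<times> vert (Suc s) ` {j<..M})"
proof -
  let ?A = "arm s" and ?B = "arm (Suc s)" and ?C = "arm (Suc (Suc s))"
  have ne: "vert s i \<noteq> vert (Suc s) j"
    by (rule vert_ne_Suc)
  obtain x y where xy: "f = {x, y}" "x < n" "y < n"
    and x: "orient (?A i) (?B j) (drawing x) > 0"
    and y: "orient (?A i) (?B j) (drawing y) < 0"
    and opp: "orient (drawing x) (drawing y) (?A i) * orient (drawing x) (drawing y) (?B j) < 0"
    using crossing_drawing_obtain[OF ne f cr] by auto
  have A: "l < i \<Longrightarrow> orient (?A i) (?B j) (?A l) > 0"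
          "i < l \<Longrightarrow> orient (?A i) (?B j) (?A l) < 0" for l
    using orient_arm_next[of i l s j] orient_arm_next[of l i s j]
      orient_swap[of "?A i" "?A l" "?B j"] orient_cycle[of "?A i" "?B j" "?A l"] by linarith+
  have sideA: "orient (?A i) (?B j) (?A l) > 0 \<Longrightarrow> l < i"
              "orient (?A i) (?B j) (?A l) < 0 \<Longrightarrow> i < l" for l
    using A[of l] by (cases l i rule: linorder_cases; simp)+
  have B: "l < j \<Longrightarrow> orient (?A i) (?B j) (?B l) > 0"
          "j < l \<Longrightarrow> orient (?A i) (?B j) (?B l) < 0" for l
    using orient_arm_prev[of j l "Suc s" i] orient_arm_prev[of l j "Suc s" i]
      orient_swap[of "?B j" "?B l" "?A i"] orient_cycle[of "?B j" "?B l" "?A i"]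
    unfolding arm_periodic by linarith+
  have sideB: "orient (?A i) (?B j) (?B l) > 0 \<Longrightarrow> l < j"
              "orient (?A i) (?B j) (?B l) < 0 \<Longrightarrow> j < l" for l
    using B[of l] by (cases l j rule: linorder_cases; simp)+
  have yC: "\<not> orient (?A i) (?B j) (?C l) < 0" for l
    using orient_three_arms[of s i j l] by simp
  show ?thesis
    using xy(3)
  proof (cases y rule: vert_cases[where s = s])
    case (same h)
    then have h: "i < h" "h \<le> M"
      using sideA y by (auto simp: M_def)
    show ?thesis
      using xy(2)
    proof (cases x rule: vert_cases[where s = s])
      case A: (same l)
      \<comment> \<open>Since A is bent towards B, the point \<open>A i\<close> is on the same side of the chord as B.\<close>
      have "l < i" using A sideA x by auto
      then have "orient (?A l) (?A h) (?A i) > 0" "orient (?A l) (?A h) (?B j) > 0"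
        using h orient_arm_concave[of l i h s] orient_arm_next[of l h s j]
          orient_cycle[of "?A l" "?A h" "?A i"] orient_swap[of "?A i" "?A l" "?A h"] by linarith+
      then show ?thesis
        using opp A same by (simp add: mult_less_0_iff)
    next
      case ("next" l)
      then have "l < j" using sideB x by auto
      then show ?thesis
        using xy same h "next" by auto
    next
      case (prev l)
      have "orient (?C l) (?A h) (?A i) > 0" "orient (?C l) (?A h) (?B j) > 0"
        using h orient_arm_prev[of i h s l] orient_three_arms[of s h j l]
          orient_cycle[of "?A h" "?A i" "?C l"] orient_swap[of "?A h" "?A i" "?C l"]
          orient_cycle[of "?A h" "?B j" "?C l"] by linarith+
      then show ?thesis
        using opp same prev by (simp add: mult_less_0_iff)
    qed
  next
    case y: ("next" h)
    then have h: "j < h" "h \<le> M"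
      using sideB \<open>orient (?A i) (?B j) (drawing y) < 0\<close> by (auto simp: M_def)
    show ?thesis
      using xy(2)
    proof (cases x rule: vert_cases[where s = s])
      case (same l)
      then have "l < i" using sideA x by auto
      then show ?thesis
        using xy same h y by auto
    next
      case ("next" l)
      then have "l < j" using sideB x by auto
      then show ?thesis
        using xy h "next" y by auto
    next
      case (prev l)
      have "orient (?C l) (?B h) (?A i) < 0" "orient (?C l) (?B h) (?B j) < 0"
        using h orient_arm_next[of j h "Suc s" l] orient_three_arms[of s i h l]
          orient_swap[of "?C l" "?B h" "?B j"] orient_cycle[of "?B h" "?C l" "?B j"]
          orient_swap[of "?C l" "?B h" "?A i"] orient_cycle[of "?B h" "?C l" "?A i"] by linarith+
      then show ?thesis
        using opp y prev by (simp add: mult_less_0_iff)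
    qed
  next
    case (prev h)
    then show ?thesis using yC y by auto
  qed
qed

text \<open>To the left of the chord from \<open>A i\<close> to \<open>A j\<close> lie the points of A in between and all of B, to its
  right the other points of A and all of C. An edge that starts in B and ends on the right passes
  the chord on the outside.\<close>

lemma crossings_within_arm:
  assumes f: "f \<in> all_edges {..<n}" and cr: "crossing drawing {vert s i, vert s j} f"
    and ij: "i < j"
  defines "M \<equiv> n div 3"
  shows "f \<in> (\<lambda>(x, y). {x, y}) `
    (vert s ` {i<..<j} \<times> (vert s ` ({..<i} \<union> {j<..M}) \<union> vert (Suc (Suc s)) ` {..M}))"
proof -
  let ?A = "arm s" and ?B = "arm (Suc s)" and ?C = "arm (Suc (Suc s))"
  have ne: "vert s i \<noteq> vert s j"
    using ij by simp
  obtain x y where xy: "f = {x, y}" "x < n" "y < n"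
    and x: "orient (?A i) (?A j) (drawing x) > 0"
    and y: "orient (?A i) (?A j) (drawing y) < 0"
    and opp: "orient (drawing x) (drawing y) (?A i) * orient (drawing x) (drawing y) (?A j) < 0"
    using crossing_drawing_obtain[OF ne f cr] by auto
  have sign: "l < i \<Longrightarrow> orient (?A i) (?A j) (?A l) < 0"
             "j < l \<Longrightarrow> orient (?A i) (?A j) (?A l) < 0"
             "i < l \<Longrightarrow> l < j \<Longrightarrow> orient (?A i) (?A j) (?A l) > 0" for l
    using ij orient_arm_concave[of l i j s] orient_arm_concave[of i j l s]
      orient_arm_concave[of i l j s]
      orient_cycle[of "?A i" "?A j" "?A l"] orient_swap[of "?A l" "?A i" "?A j"] by linarith+
  have between: "i < l \<and> l < j" if "orient (?A i) (?A j) (?A l) > 0" for l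
    using that sign[of l] by (cases l i rule: linorder_cases; cases l j rule: linorder_cases; simp)
  have outside: "l < i \<or> j < l" if "orient (?A i) (?A j) (?A l) < 0" for l
    using that sign[of l] by (cases l i rule: linorder_cases; cases l j rule: linorder_cases; simp)
  show ?thesis
    using xy(2)
  proof (cases x rule: vert_cases[where s = s])
    case (same l)
    then have l: "i < l" "l < j"
      using between x by auto
    show ?thesis
      using xy(3)
    proof (cases y rule: vert_cases[where s = s])
      case A: (same h)
      then have "h < i \<or> j < h" using outside y by auto
      then show ?thesis
        using xy l same A by (auto simp: M_def)
    next
      case ("next" h)
      then show ?thesis
        using y orient_arm_next[OF ij, of s h] by simp
    next
      case (prev h)
      then show ?thesis
        using xy l same by (auto simp: M_def)
    qed
  next
    case x: ("next" l)
    show ?thesis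
      using xy(3)
    proof (cases y rule: vert_cases[where s = s])
      case (same h)
      then have "h < i \<or> j < h" using outside y by auto
      moreover have "orient (?B l) (?A h) (?A a) > 0" if "h < a" for a
        using orient_arm_next[OF that, of s l] orient_cycle[of "?A h" "?A a" "?B l"] by simp
      moreover have "orient (?B l) (?A h) (?A a) < 0" if "a < h" for a
        using orient_arm_next[OF that, of s l] orient_cycle[of "?A h" "?A a" "?B l"]
          orient_swap[of "?A h" "?A a" "?B l"] by linarith
      ultimately have "orient (?B l) (?A h) (?A i) * orient (?B l) (?A h) (?A j) > 0"
        using ij by (auto simp: zero_less_mult_iff dest: less_trans)
      then show ?thesis
        using opp x same by simp
    next
      case ("next" h)
      then show ?thesis
        using y orient_arm_next[OF ij, of s h] by simp
    next
      case (prev h)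
      have "orient (?B l) (?C h) (?A a) > 0" for a
        using orient_three_arms[of s a l h] 
          orient_cycle[of "?B l" "?C h" "?A a"] by linarith
      then have "orient (?B l) (?C h) (?A i) * orient (?B l) (?C h) (?A j) > 0"
        by (intro mult_pos_pos)
      then show ?thesis
        using opp x prev by simp
    qed
  next
    case (prev l)
    then show ?thesis
      using x orient_arm_prev[OF ij, of s l] by simp
  qed
qed

text \<open>The sets of \<open>crossings_between_arms\<close> give \<open>j (M - i) + (i + j) (M - j)\<close> edges, where \<open>M\<close> is
  the largest place on an arm; this is at most \<open>M\<^sup>2\<close> on the square \<open>0 \<le> i, j \<le> M\<close>.\<close>

lemma card_crossings_between_arms:
  assumes "i \<le> n div 3" "j \<le> n div 3"
  shows "card {f \<in> all_edges {..<n}. crossing drawing {vert s i, vert (Suc s) j} f} \<le> (n div 3)\<^sup>2"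
proof -
  define M where "M = n div 3"
  let ?A = "\<lambda>I. vert s ` I" and ?B = "\<lambda>I. vert (Suc s) ` I"
  let ?X = "?B {..<j} \<times> ?A {i<..M}"
  let ?Y = "(?A {..<i} \<union> ?B {..<j}) \<times> ?B {j<..M}"
  have "card {f \<in> all_edges {..<n}. crossing drawing {vert s i, vert (Suc s) j} f}
      \<le> card ((\<lambda>(x, y). {x, y}) ` (?X \<union> ?Y))"
    using crossings_between_arms unfolding M_def by (intro card_mono) auto
  also have "\<dots> \<le> card (?X \<union> ?Y)"
    by (intro card_image_le) auto
  also have "\<dots> \<le> card ?X + card ?Y"
    by (rule card_Un_le)
  also have "\<dots> \<le> j * (M - i) + (i + j) * (M - j)"
    unfolding card_cartesian_product
    by (intro add_mono mult_mono order_trans[OF card_Un_le] order_trans[OF card_image_le]) auto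
  also have "\<dots> \<le> M\<^sup>2"
  proof -
    have "i \<le> M" "j \<le> M"
      using assms by (auto simp: M_def)
    \<comment> \<open>The difference of both sides is affine in \<open>i\<close>, with the value \<open>(M - j)\<^sup>2\<close> at \<open>i = 0\<close> and \<open>j\<^sup>2\<close>
        at \<open>i = M\<close>. The identity interpolates between these values and is multiplied by \<open>M\<close>.\<close>
    have "int M * (int j * (int M - int i) + (int i + int j) * (int M - int j))
        = int M * (int M)\<^sup>2 - ((int M - int i) * (int M - int j)\<^sup>2 + int i * (int j)\<^sup>2)"
      by (simp add: algebra_simps power2_eq_square)
    also have "\<dots> \<le> int M * (int M)\<^sup>2"
    proof -
      have "0 \<le> (int M - int i) * (int M - int j)\<^sup>2 + int i * (int j)\<^sup>2"
        using \<open>i \<le> M\<close> by (intro add_nonneg_nonneg mult_nonneg_nonneg) auto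
      then show ?thesis
        by linarith
    qed
    finally have "M = 0 \<or> int j * (int M - int i) + (int i + int j) * (int M - int j) \<le> (int M)\<^sup>2"
      by (auto simp: mult_le_cancel_left)
    then have "M = 0 \<or> int (j * (M - i) + (i + j) * (M - j)) \<le> int (M\<^sup>2)"
      using \<open>i \<le> M\<close> \<open>j \<le> M\<close> by (simp add: of_nat_diff)
    then show ?thesis
      using \<open>i \<le> M\<close> \<open>j \<le> M\<close> by (elim disjE) (simp_all only: of_nat_le_iff, simp)
  qed
  finally show ?thesis
    by (simp add: M_def)
qed

text \<open>With \<open>t\<close> points strictly between the endpoints, there are \<open>2 M - t\<close> possible endpoints on
  the other side, and \<open>t (2 M - t) = M\<^sup>2 - (M - t)\<^sup>2\<close>.\<close>

lemma card_crossings_within_arm: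
  assumes "i < j" "j \<le> n div 3"
  shows "card {f \<in> all_edges {..<n}. crossing drawing {vert s i, vert s j} f} \<le> (n div 3)\<^sup>2"
proof -
  define M where "M = n div 3"
  define t where "t = j - Suc i"
  let ?X = "vert s ` {i<..<j}"
  let ?Y = "vert s ` ({..<i} \<union> {j<..M}) \<union> vert (Suc (Suc s)) ` {..M}"
  have "card {f \<in> all_edges {..<n}. crossing drawing {vert s i, vert s j} f}
      \<le> card ((\<lambda>(x, y). {x, y}) ` (?X \<times> ?Y))"
    using crossings_within_arm \<open>i < j\<close> unfolding M_def by (intro card_mono) auto
  also have "\<dots> \<le> card (?X \<times> ?Y)"
    by (intro card_image_le) auto
  also have "\<dots> \<le> t * ((i + (M - j)) + Suc M)"
    unfolding card_cartesian_product t_def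
    by (intro add_mono mult_mono order_trans[OF card_Un_le] order_trans[OF card_image_le]) auto
  also have "\<dots> \<le> M\<^sup>2"
  proof -
    have t: "t + i + 1 = j" "j \<le> M"
      using assms by (auto simp: t_def M_def)
    then have "(i + (M - j)) + Suc M + t = 2 * M"
      by linarith
    then have "int (i + (M - j) + Suc M) = 2 * int M - int t"
      by linarith
    then have "int (t * ((i + (M - j)) + Suc M)) = int t * (2 * int M - int t)"
      by (simp only: of_nat_mult)
    also have "\<dots> = (int M)\<^sup>2 - (int M - int t)\<^sup>2"
      by (simp add: power2_eq_square algebra_simps)
    also have "\<dots> \<le> int (M\<^sup>2)"
      by simp
    finally show ?thesis
      by (simp only: of_nat_le_iff)
  qed
  finally show ?thesis
    by (simp add: M_def)
qed

lemma card_crossings_le: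
  assumes "e \<in> all_edges {..<n}"
  shows "card {f \<in> all_edges {..<n}. crossing drawing e f} \<le> (n div 3)\<^sup>2"
proof -
  obtain u v where uv: "e = {u, v}" "u \<noteq> v" "u < n" "v < n"
    using assms by (auto simp: all_edges_def card_2_iff)
  define s i where "s = u" and "i = u div 3"
  have u: "u = vert s i" "i \<le> n div 3"
    using uv(3) by (simp_all add: vert_def s_def i_def div_le_mono)
  show ?thesis
    using uv(4)
  proof (cases v rule: vert_cases[where s = s])
    case (same j)
    then consider "i < j" | "j < i"
      using uv(2) u(1) by fastforce
    then show ?thesis
    proof cases
      case 1
      then show ?thesis
        unfolding uv(1) u(1) same(2) using same(1) by (rule card_crossings_within_arm)
    next
      case 2
      then show ?thesis
        unfolding uv(1) u(1) same(2) insert_commute[of "vert s i"]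
        using u(2) by (rule card_crossings_within_arm)
    qed
  next
    case ("next" j)
    show ?thesis
      unfolding uv(1) u(1) "next"(2) using u(2) "next"(1) by (rule card_crossings_between_arms)
  next
    case (prev j)
    \<comment> \<open>The arm after that of \<open>v\<close> is the arm of \<open>u\<close>.\<close>
    show ?thesis
      using card_crossings_between_arms[OF prev(1) u(2), of "Suc (Suc s)"]
      unfolding uv(1) u(1) prev(2) vert_periodic insert_commute[of "vert s i"] .
  qed
qed

section \<open>Pseudo-Grundy colorings and degrees\<close>

lemma pseudo_grundy_index_attained:
  assumes "finite E"
  shows "\<exists>c. pseudo_grundy_coloring adj E (pseudo_grundy_index adj E) c"
  unfolding pseudo_grundy_index_def
proof (rule GreatestI_ex_nat)
  show "\<exists>k c. pseudo_grundy_coloring adj E k c"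
    by (rule pseudo_grundy_coloring_exists)
  show "\<And>k. \<exists>c. pseudo_grundy_coloring adj E k c \<Longrightarrow> k \<le> card E"
    using pseudo_grundy_coloring_le_card[OF assms] by blast
qed

text \<open>An edge of the largest color sees every smaller color among its neighbors.\<close>

lemma pseudo_grundy_index_le_degree:
  assumes "finite E" and deg: "\<And>e. e \<in> E \<Longrightarrow> card {f \<in> E. adj e f} \<le> D"
  shows "pseudo_grundy_index adj E \<le> D + 1"
proof -
  define k where "k = pseudo_grundy_index adj E"
  obtain c where c: "pseudo_grundy_coloring adj E k c"
    using pseudo_grundy_index_attained[OF assms(1)] unfolding k_def by blast
  show ?thesis
  proof (cases "k = 0")
    case False
    then have "k \<in> c ` E"
      using c by (simp add: pseudo_grundy_coloring_def)
    then obtain e where e: "e \<in> E" "c e = k"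
      by blast
    have "{1..<k} \<subseteq> c ` {f \<in> E. adj e f}"
    proof
      fix i assume "i \<in> {1..<k}"
      then have "i \<in> {1..k}" "k \<in> {1..k}" "i < k"
        by auto
      then have "\<exists>f\<in>E. c f = i \<and> adj e f"
        using c e unfolding pseudo_grundy_coloring_def by blast
      then show "i \<in> c ` {f \<in> E. adj e f}"
        by blast
    qed
    then have "card {1..<k} \<le> card {f \<in> E. adj e f}"
      using assms(1) by (intro surj_card_le) auto
    then show ?thesis
      using deg[OF e(1)] by (simp add: k_def)
  qed (simp add: k_def)
qed

lemma finite_all_edges: "finite V \<Longrightarrow> finite (all_edges V)"
  by (simp add: all_edges_def)

lemma card_intersecting_le:
  assumes "finite V" "e \<in> all_edges V"
  shows "card {f \<in> all_edges V. intersecting p e f}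
    \<le> card {f \<in> all_edges V. crossing p e f} + 2 * card V"
proof -
  obtain u v where uv: "e = {u, v}"
    using assms by (auto simp: all_edges_def card_2_iff)
  have "f \<in> (\<lambda>w. {u, w}) ` V \<union> (\<lambda>w. {v, w}) ` V" if "f \<in> all_edges V" "e \<inter> f \<noteq> {}" for f
    using that uv by (auto simp: all_edges_def card_2_iff)
  then have "{f \<in> all_edges V. intersecting p e f} \<subseteq>
      {f \<in> all_edges V. crossing p e f} \<union> ((\<lambda>w. {u, w}) ` V \<union> (\<lambda>w. {v, w}) ` V)"
    by (auto simp: intersecting_def)
  then have "card {f \<in> all_edges V. intersecting p e f} \<le>
      card ({f \<in> all_edges V. crossing p e f} \<union> ((\<lambda>w. {u, w}) ` V \<union> (\<lambda>w. {v, w}) ` V))"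
    using assms(1) by (intro card_mono) (auto simp: finite_all_edges)
  also have "\<dots> \<le> card {f \<in> all_edges V. crossing p e f} + (card V + card V)"
    using assms(1) by (intro order_trans[OF card_Un_le] add_mono card_image_le) auto
  finally show ?thesis
    by simp
qed

lemma geometric_index_bound:
  assumes deg: "\<And>e. e \<in> all_edges {..<n} \<Longrightarrow>
      card {f \<in> all_edges {..<n}. crit drawing e f} \<le> (n div 3)\<^sup>2 + 2 * n"
  shows "real (geometric_pseudo_grundy_index crit {..<n} (all_edges {..<n}))
    \<le> (real n)\<^sup>2 / 9 + 3 * real n"
proof -
  let ?E = "all_edges {..<n}"
  have "geometric_pseudo_grundy_index crit {..<n} ?E \<le> pseudo_grundy_index (crit drawing) ?E"
    unfolding geometric_pseudo_grundy_index_def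
    using geometric_drawing_drawing by (intro Least_le) blast
  also have "\<dots> \<le> (n div 3)\<^sup>2 + 3 * n"
  proof (cases "n = 0")
    case True
    \<comment> \<open>Without edges there is no color either, so the bound needs no constant term.\<close>
    obtain c where "pseudo_grundy_coloring (crit drawing) ?E (pseudo_grundy_index (crit drawing) ?E) c"
      using pseudo_grundy_index_attained[of ?E] by (auto simp: finite_all_edges)
    then have "pseudo_grundy_index (crit drawing) ?E \<le> card ?E"
      by (intro pseudo_grundy_coloring_le_card) (auto simp: finite_all_edges)
    moreover have "?E = {}"
      using True by (auto simp: all_edges_def)
    ultimately show ?thesis
      by simp
  next
    case False
    have "pseudo_grundy_index (crit drawing) ?E \<le> ((n div 3)\<^sup>2 + 2 * n) + 1"
      using deg by (intro pseudo_grundy_index_le_degree) (auto simp: finite_all_edges)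
    then show ?thesis
      using False by linarith
  qed
  finally have "real (geometric_pseudo_grundy_index crit {..<n} ?E) \<le> real ((n div 3)\<^sup>2 + 3 * n)"
    by (simp only: of_nat_le_iff)
  also have "\<dots> \<le> (real n / 3)\<^sup>2 + 3 * real n"
  proof -
    have "3 * (n div 3) \<le> n"
      by simp
    then have "3 * real (n div 3) \<le> real n"
      by (metis of_nat_le_iff of_nat_mult of_nat_numeral)
    then have "real (n div 3) \<le> real n / 3"
      by linarith
    then have "(real (n div 3))\<^sup>2 \<le> (real n / 3)\<^sup>2"
      by (intro power_mono) auto
    then show ?thesis
      by simp
  qed
  finally show ?thesis
    by (simp add: power_divide)
qed

theorem theorem8:
  shows "(\<exists>C>0. \<forall>n::nat.
            real (geometric_pseudo_grundy_index crossing {..<n} (all_edges {..<n}))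
              \<le> (real n)\<^sup>2 / 9 + C * real n)
       \<and> (\<exists>C>0. \<forall>n::nat.
            real (geometric_pseudo_grundy_index intersecting {..<n} (all_edges {..<n}))
              \<le> (real n)\<^sup>2 / 9 + C * real n)"
proof (intro conjI exI[of _ 3] allI)
  fix n :: nat
  show "real (geometric_pseudo_grundy_index crossing {..<n} (all_edges {..<n}))
      \<le> (real n)\<^sup>2 / 9 + 3 * real n"
    using card_crossings_le by (intro geometric_index_bound) (simp add: trans_le_add1)
  have "card {f \<in> all_edges {..<n}. intersecting drawing e f} \<le> (n div 3)\<^sup>2 + 2 * n"
    if "e \<in> all_edges {..<n}" for e
    using card_intersecting_le[of "{..<n}" e drawing] card_crossings_le[OF that] that by simp
  then show "real (geometric_pseudo_grundy_index intersecting {..<n} (all_edges {..<n}))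
      \<le> (real n)\<^sup>2 / 9 + 3 * real n"
    by (rule geometric_index_bound)
qed simp_all

end
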